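(* Let $\alpha,\gamma,\kappa>-1$ be real numbers with $\alpha+\kappa>-\frac32$, and let $p_{n,k}^{\alpha,\gamma,\kappa}$ and $p_{n,k}^{\alpha+1,\gamma,\kappa+1}$ $(n,k\in\mathbb{N}_0)$ be the monic symmetric orthogonal bases associated with $w_{\alpha,\gamma,\kappa}$ and $w_{\alpha+1,\gamma,\kappa+1}$, respectively. Then, for all $n,k\in\mathbb{N}_0$, \[ D_{-}\big[p_{n,k}^{\alpha,\gamma,\kappa}(x,y)\big]=k\,p_{n,k-1}^{\alpha+1,\gamma,\kappa+1}(x,y), \] where the right-hand side is understood to be zero when $k=0$, and \[ D_{+}^{\alpha,\kappa}\big[p_{n,k}^{\alpha+1,\gamma,\kappa+1}(x,y)\big]=4(k+\alpha+\kappa+2)\,p_{n,k+1}^{\alpha,\gamma,\kappa}(x,y). \]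
   Context: All polynomials have real coefficients; symmetric means invariant under interchange of $x$ and $y$. Let $\mathbf{T}^2=\{(x,y)\in\mathbb{R}^2:\ x\ge0,\ y\ge0,\ x+y\le1\}$, $\triangle=\{(x,y)\in\mathbf{T}^2:\ y<x\}$, and \[ w_{\alpha,\gamma,\kappa}(x,y)=(xy)^{\alpha}(1-x-y)^{\gamma}|x-y|^{2\kappa+1}. \] Order on $\mathbb{N}_0^2$ (with $\mathbb{N}_0$ the nonnegative integers): $(m,l)\prec(n,k)$ if and only if $m+2l<n+2k$, or $m+2l=n+2k$ and $l<k$; this is a strict total order. Every symmetric polynomial is uniquely a finite linear combination of the monomials $(x+y)^n(xy)^k$; the largest pair $(n,k)$ (for $\prec$) occurring with nonzero coefficient is its symmetric degree. Monic orthogonal basis (for parameters $>-1$ with $\alpha+\kappa>-\frac32$): $p_{n,k}^{\alpha,\gamma,\kappa}$ is obtained by Gram--Schmidt (without normalization of norms, with leading coefficient $1$) from the monomials $(x+y)^n(xy)^k$ ordered by $\prec$; i.e. it is the unique symmetric polynomial equal to $(x+y)^n(xy)^k$ plus a linear combination of $(x+y)^m(xy)^l$ with $(m,l)\prec(n,k)$, and satisfying $\int_{\triangle}p_{n,k}^{\alpha,\gamma,\kappa}\,q\,w_{\alpha,\gamma,\kappa}\,dx\,dy=0$ for every symmetric polynomial $q$ of symmetric degree $\prec(n,k)$. Operators: \[ D_{-}:=\frac{\partial_y-\partial_x}{x-y},\qquad D_{+}^{\alpha,\kappa}:=\frac{-1}{(xy)^\alpha(x-y)^{2\kappa}}D_{-}\left[(xy)^{\alpha+1}(x-y)^{2\kappa+2}\,\cdot\right],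 \] the latter being equal to $D_{+}^{\alpha,\kappa}=xy(x-y)(\partial_x-\partial_y)+4(\kappa+1)xy-(\alpha+1)(x-y)^2$. For $f$ a symmetric polynomial, $(\partial_y-\partial_x)f$ is divisible by $x-y$, so $D_-f$ is a polynomial. *)

theory Defs
  imports "HOL-Analysis.Analysis" "HOL-Computational_Algebra.Polynomial"
begin

section \<open>Real polynomials in two variables\<close>

text \<open>
  A polynomial in $x,y$ is a polynomial in $y$ whose coefficients are polynomials in $x$.
\<close>

type_synonym bipoly = "real poly poly"

definition X :: bipoly where "X = [:[:0, 1:]:]"

definition Y :: bipoly where "Y = [:0, 1:]"

definition scale :: "real \<Rightarrow> bipoly \<Rightarrow> bipoly" where
  "scale a f = smult [:a:] f"

definition eval :: "bipoly \<Rightarrow> real \<Rightarrow> real \<Rightarrow> real" where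
  "eval f x y = poly (poly f [:y:]) x"

definition dX :: "bipoly \<Rightarrow> bipoly" where "dX f = map_poly pderiv f"

definition dY :: "bipoly \<Rightarrow> bipoly" where "dY f = pderiv f"

definition sym_poly :: "bipoly \<Rightarrow> bool" where
  "sym_poly f \<longleftrightarrow> (\<forall>x y. eval f x y = eval f y x)"


section \<open>Symmetric degree\<close>

definition prec :: "nat \<times> nat \<Rightarrow> nat \<times> nat \<Rightarrow> bool" (infix "\<prec>\<^sub>d" 50) where
  "i \<prec>\<^sub>d j \<longleftrightarrow> (case (i, j) of ((m, l), (n, k)) \<Rightarrow>
     m + 2 * l < n + 2 * k \<or> (m + 2 * l = n + 2 * k \<and> l < k))"

definition sym_mon :: "nat \<times> nat \<Rightarrow> bipoly" where
  "sym_mon i = (X + Y) ^ fst i * (X * Y) ^ snd i"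

text \<open>The zero polynomial has no symmetric degree.\<close>

definition has_sym_degree :: "bipoly \<Rightarrow> nat \<times> nat \<Rightarrow> bool" where
  "has_sym_degree q d \<longleftrightarrow>
     (\<exists>c :: nat \<times> nat \<Rightarrow> real.
        finite {i. c i \<noteq> 0} \<and>
        q = (\<Sum>i | c i \<noteq> 0. scale (c i) (sym_mon i)) \<and>
        c d \<noteq> 0 \<and> (\<forall>i. c i \<noteq> 0 \<longrightarrow> i \<prec>\<^sub>d d \<or> i = d))"

lemma finite_prec: "finite {i. i \<prec>\<^sub>d j}"
proof (rule finite_subset)
  show "{i. i \<prec>\<^sub>d j} \<subseteq> {..fst j + 2 * snd j} \<times> {..fst j + 2 * snd j}"
    by (cases j) (auto simp: prec_def)
qed simp


section \<open>Monic orthogonal basis\<close>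

definition simplex2 :: "(real \<times> real) set" where
  "simplex2 = {(x, y). 0 \<le> x \<and> 0 \<le> y \<and> x + y \<le> 1}"

definition triangle :: "(real \<times> real) set" where
  "triangle = {(x, y). (x, y) \<in> simplex2 \<and> y < x}"

definition weight :: "real \<Rightarrow> real \<Rightarrow> real \<Rightarrow> real \<Rightarrow> real \<Rightarrow> real" where
  "weight \<alpha> \<gamma> \<kappa> x y =
     (x * y) powr \<alpha> * (1 - x - y) powr \<gamma> * \<bar>x - y\<bar> powr (2 * \<kappa> + 1)"

definition orth :: "real \<Rightarrow> real \<Rightarrow> real \<Rightarrow> bipoly \<Rightarrow> bipoly \<Rightarrow> bool" where
  "orth \<alpha> \<gamma> \<kappa> p q \<longleftrightarrow>
     (LINT (x, y):triangle|lborel. eval p x y * eval q x y * weight \<alpha> \<gamma> \<kappa> x y) = 0"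

definition is_monic_orth :: "real \<Rightarrow> real \<Rightarrow> real \<Rightarrow> nat \<Rightarrow> nat \<Rightarrow> bipoly \<Rightarrow> bool" where
  "is_monic_orth \<alpha> \<gamma> \<kappa> n k p \<longleftrightarrow>
     sym_poly p \<and>
     (\<exists>c :: nat \<times> nat \<Rightarrow> real.
        p = sym_mon (n, k) + (\<Sum>i | i \<prec>\<^sub>d (n, k). scale (c i) (sym_mon i))) \<and>
     (\<forall>q d. sym_poly q \<and> has_sym_degree q d \<and> d \<prec>\<^sub>d (n, k) \<longrightarrow> orth \<alpha> \<gamma> \<kappa> p q)"

definition monic_orth :: "real \<Rightarrow> real \<Rightarrow> real \<Rightarrow> nat \<Rightarrow> nat \<Rightarrow> bipoly" where
  "monic_orth \<alpha> \<gamma> \<kappa> n k = (THE p. is_monic_orth \<alpha> \<gamma> \<kappa> n k p)"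


section \<open>The operators\<close>

text \<open>
  \<open>D_minus_fun\<close> is the operator $D_-$ on arbitrary functions of two real variables, meaningful
  for $x \neq y$.  On polynomials $D_-$ is given by division in the polynomial ring, which is
  exact on symmetric polynomials (\<open>D_minus_exact\<close>, \<open>eval_D_minus\<close>).
\<close>

definition D_minus_fun :: "(real \<Rightarrow> real \<Rightarrow> real) \<Rightarrow> real \<Rightarrow> real \<Rightarrow> real" where
  "D_minus_fun f x y = (deriv (\<lambda>t. f x t) y - deriv (\<lambda>s. f s y) x) / (x - y)"

definition D_minus :: "bipoly \<Rightarrow> bipoly" where
  "D_minus f = (dY f - dX f) div (X - Y)"

definition D_plus_fun ::
    "real \<Rightarrow> real \<Rightarrow> (real \<Rightarrow> real \<Rightarrow> real) \<Rightarrow> real \<Rightarrow> real \<Rightarrow> real" where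
  "D_plus_fun \<alpha> \<kappa> f x y =
     - 1 / ((x * y) powr \<alpha> * (x - y) powr (2 * \<kappa>)) *
     D_minus_fun (\<lambda>s t. (s * t) powr (\<alpha> + 1) * (s - t) powr (2 * \<kappa> + 2) * f s t) x y"

text \<open>
  The real powers in \<open>D_plus_fun\<close> make sense for $0 < y < x$.  A polynomial is determined by its
  values there, so this defines the polynomial $D_+ f$; its closed form is \<open>D_plus_eq\<close>.
\<close>

definition D_plus :: "real \<Rightarrow> real \<Rightarrow> bipoly \<Rightarrow> bipoly" where
  "D_plus \<alpha> \<kappa> f =
     (THE g. \<forall>x y. 0 < y \<and> y < x \<longrightarrow> eval g x y = D_plus_fun \<alpha> \<kappa> (eval f) x y)"

lemma eval_simps [simp]:
  "eval X x y = x" "eval Y x y = y" "eval 0 x y = 0" "eval 1 x y = 1"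
  "eval (f + g) x y = eval f x y + eval g x y"
  "eval (f - g) x y = eval f x y - eval g x y"
  "eval (f * g) x y = eval f x y * eval g x y"
  "eval (f ^ n) x y = eval f x y ^ n"
  "eval (scale a f) x y = a * eval f x y"
  by (simp_all add: eval_def X_def Y_def scale_def poly_power)

lemma eval_has_dX: "((\<lambda>s. eval f s y) has_real_derivative eval (dX f) x y) (at x)"
proof (induction f)
  case 0
  then show ?case by (simp add: dX_def)
next
  case (pCons a f)
  have "((\<lambda>s. poly a s + y * eval f s y) has_real_derivative
      poly (pderiv a) x + y * eval (dX f) x y) (at x)"
    by (auto intro!: derivative_eq_intros pCons.IH poly_DERIV)
  then show ?case
    using pCons.hyps by (simp add: dX_def eval_def map_poly_pCons)
qed

lemma eval_has_dY: "((\<lambda>t. eval f x t) has_real_derivative eval (dY f) x y) (at y)"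
proof (induction f)
  case 0
  then show ?case by (simp add: dY_def)
next
  case (pCons a f)
  have "((\<lambda>t. poly a x + t * eval f x t) has_real_derivative
      eval f x y + y * eval (dY f) x y) (at y)"
    by (auto intro!: derivative_eq_intros pCons.IH)
  then show ?case
    by (simp add: dY_def eval_def pderiv_pCons)
qed

lemma poly_eq_0_on_interval:
  fixes p :: "real poly"
  assumes "a < b" "\<And>x. a < x \<Longrightarrow> x < b \<Longrightarrow> poly p x = 0"
  shows "p = 0"
proof (rule ccontr)
  assume "p \<noteq> 0"
  then have "finite {x. poly p x = 0}" by (rule poly_roots_finite)
  moreover have "{a<..<b} \<subseteq> {x. poly p x = 0}" using assms by auto
  ultimately have "finite {a<..<b}" using finite_subset by blast
  then show False using assms(1) by (simp add: infinite_Ioo)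
qed

lemma bipoly_eq_0:
  assumes "\<And>x y. 0 < y \<Longrightarrow> y < x \<Longrightarrow> eval f x y = 0"
  shows "f = 0"
proof (rule ccontr)
  assume "f \<noteq> 0"
  then have "finite {c. poly f c = 0}" by (rule poly_roots_finite)
  moreover have "(\<lambda>y. [:y:]) ` {0<..<1::real} \<subseteq> {c. poly f c = 0}"
  proof safe
    fix y :: real assume "y \<in> {0<..<1}"
    then show "poly f [:y:] = 0"
      using poly_eq_0_on_interval[of y "y + 1" "poly f [:y:]"] assms
      by (simp add: eval_def)
  qed
  ultimately have "finite ((\<lambda>y. [:y:]) ` {0<..<1::real})" using finite_subset by blast
  then have "finite {0<..<1::real}" by (rule finite_imageD) (simp add: inj_on_def)
  then show False by (simp add: infinite_Ioo)
qed

lemma bipoly_eqI: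
  assumes "\<And>x y. 0 < y \<Longrightarrow> y < x \<Longrightarrow> eval f x y = eval g x y"
  shows "f = g"
  using bipoly_eq_0[of "f - g"] assms by simp

lemma D_minus_exact:
  assumes "sym_poly f"
  shows "(X - Y) * D_minus f = dY f - dX f"
proof -
  let ?h = "dY f - dX f"
  have "poly (poly ?h [:0, 1:]) x = 0" for x
  proof -
    have "(\<lambda>t. eval f x t) = (\<lambda>t. eval f t x)"
      using assms by (simp add: sym_poly_def)
    then have "eval (dY f) x x = eval (dX f) x x"
      using eval_has_dX[of f x x] eval_has_dY[of f x x] DERIV_unique by fastforce
    moreover have "poly (poly g [:0, 1:]) x = eval g x x" for g :: bipoly
      by (induction g) (simp_all add: eval_def)
    ultimately show ?thesis by (simp del: poly_diff)
  qed
  then have "poly ?h [:0, 1:] = 0" using poly_all_0_iff_0 by blast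
  then have "[:- [:0, 1:], 1:] dvd ?h" by (simp only: poly_eq_0_iff_dvd)
  moreover have "X - Y = - [:- [:0, 1:], 1:]" by (simp add: X_def Y_def)
  ultimately have "X - Y dvd ?h" by (metis minus_dvd_iff)
  then show ?thesis by (simp add: D_minus_def)
qed

lemma eval_D_minus:
  assumes "sym_poly f" "x \<noteq> y"
  shows "eval (D_minus f) x y = D_minus_fun (eval f) x y"
proof -
  have "(x - y) * eval (D_minus f) x y = eval ((X - Y) * D_minus f) x y" by simp
  also have "\<dots> = eval (dY f) x y - eval (dX f) x y"
    by (simp only: D_minus_exact[OF assms(1)] eval_simps)
  finally show ?thesis
    using assms(2) DERIV_imp_deriv[OF eval_has_dX] DERIV_imp_deriv[OF eval_has_dY]
    by (simp add: D_minus_fun_def field_simps)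
qed

lemma D_plus_fun_eval:
  assumes "0 < y" "y < x"
  shows "D_plus_fun \<alpha> \<kappa> (eval f) x y =
    x * y * (x - y) * (eval (dX f) x y - eval (dY f) x y)
    + 4 * (\<kappa> + 1) * (x * y) * eval f x y - (\<alpha> + 1) * (x - y)\<^sup>2 * eval f x y"
proof -
  define a where "a = (x * y) powr \<alpha>"
  define b where "b = (x - y) powr (2 * \<kappa>)"
  have pos: "x * y > 0" "x - y > 0" "x > 0" using assms by auto
  have ab: "a > 0" "b > 0" using pos by (auto simp: a_def b_def)
  have a1: "(x * y) powr (\<alpha> + 1) = a * (x * y)"
    using pos by (simp add: a_def powr_add)
  have b1: "(x - y) powr (2 * \<kappa> + 1) = b * (x - y)"
    using pos by (simp add: b_def powr_add)
  have b2: "(x - y) powr (2 * \<kappa> + 2) = b * (x - y)\<^sup>2"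
    using pos by (simp add: b_def powr_add)
  let ?g = "\<lambda>s t. (s * t) powr (\<alpha> + 1) * (s - t) powr (2 * \<kappa> + 2) * eval f s t"
  have dx: "((\<lambda>s. ?g s y) has_real_derivative
      ((\<alpha> + 1) * a * y) * (b * (x - y)\<^sup>2) * eval f x y
      + (a * (x * y)) * ((2 * \<kappa> + 2) * (b * (x - y))) * eval f x y
      + (a * (x * y)) * (b * (x - y)\<^sup>2) * eval (dX f) x y) (at x)"
  proof -
    have "((\<lambda>s. (s * y) powr (\<alpha> + 1)) has_real_derivative (\<alpha> + 1) * a * y) (at x)"
      using pos by (auto intro!: derivative_eq_intros simp: a_def)
    moreover have "((\<lambda>s. (s - y) powr (2 * \<kappa> + 2)) has_real_derivative
        (2 * \<kappa> + 2) * (b * (x - y))) (at x)"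
      unfolding b1[symmetric] using pos
      by (auto intro!: derivative_eq_intros simp: add.commute)
    ultimately show ?thesis
      by (rule DERIV_mult[OF DERIV_mult eval_has_dX, THEN DERIV_cong])
         (simp only: a1 b2, simp add: algebra_simps)
  qed
  have dy: "((\<lambda>t. ?g x t) has_real_derivative
      ((\<alpha> + 1) * a * x) * (b * (x - y)\<^sup>2) * eval f x y
      - (a * (x * y)) * ((2 * \<kappa> + 2) * (b * (x - y))) * eval f x y
      + (a * (x * y)) * (b * (x - y)\<^sup>2) * eval (dY f) x y) (at y)"
  proof -
    have "((\<lambda>t. (x * t) powr (\<alpha> + 1)) has_real_derivative (\<alpha> + 1) * a * x) (at y)"
      using pos by (auto intro!: derivative_eq_intros simp: a_def)
    moreover have "((\<lambda>t. (x - t) powr (2 * \<kappa> + 2)) has_real_derivative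
        - ((2 * \<kappa> + 2) * (b * (x - y)))) (at y)"
      unfolding b1[symmetric] using pos
      by (auto intro!: derivative_eq_intros simp: add.commute)
    ultimately show ?thesis
      by (rule DERIV_mult[OF DERIV_mult eval_has_dY, THEN DERIV_cong])
         (simp only: a1 b2, simp add: algebra_simps)
  qed
  show ?thesis
    unfolding D_plus_fun_def D_minus_fun_def DERIV_imp_deriv[OF dx] DERIV_imp_deriv[OF dy]
      a_def[symmetric] b_def[symmetric]
    using ab pos by (simp add: divide_simps) (simp add: algebra_simps power2_eq_square)
qed

lemma D_plus_eq:
  "D_plus \<alpha> \<kappa> f = X * Y * (X - Y) * (dX f - dY f)
     + scale (4 * (\<kappa> + 1)) (X * Y * f) - scale (\<alpha> + 1) ((X - Y) ^ 2 * f)"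
  (is "_ = ?g")
  unfolding D_plus_def
proof (rule the_equality)
  show "\<forall>x y. 0 < y \<and> y < x \<longrightarrow> eval ?g x y = D_plus_fun \<alpha> \<kappa> (eval f) x y"
    by (simp add: D_plus_fun_eval)
next
  fix g
  assume *: "\<forall>x y. 0 < y \<and> y < x \<longrightarrow> eval g x y = D_plus_fun \<alpha> \<kappa> (eval f) x y"
  show "g = ?g"
    by (rule bipoly_eqI) (use * in \<open>simp add: D_plus_fun_eval\<close>)
qed

end

theory Submission
  imports Defs
begin

text \<open>
  In the coordinates $s = x + y$ and $m = xy$ the operator $D_-$ is $\partial_m$, and
  $D_+$ sends $s^n m^k$ to $4(k+\alpha+\kappa+2)\, s^n m^{k+1} - (k+\alpha+1)\, s^{n+2} m^k$.  The two
  operators are adjoint: from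
  $D_+(pq) = p\, D_+ q - xy(x-y)^2 (D_- p)\, q$ and
  $w_{\alpha+1,\gamma,\kappa+1} = xy(x-y)^2 w_{\alpha,\gamma,\kappa}$ this reduces to $D_+ f$ having
  integral zero, which on monomials is a recurrence between two moments.  Writing
  $x = s(1+u)/2$, $y = s(1-u)/2$ turns each moment into a product of two Beta integrals, and the
  recurrence into that of the Beta function.  Since $D_-$ lowers and $D_+$ raises the index $k$ by
  one compatibly with $\prec$, adjointness shows that both images satisfy the characterization of a
  monic orthogonal polynomial, up to the leading coefficient.
\<close>

section \<open>Moments of the weight\<close>

text \<open>Recasting the pairing as a linear functional of the product \<open>p * q\<close> lets
  factors move freely between the two arguments.\<close>

definition moment_int :: "real \<Rightarrow> real \<Rightarrow> real \<Rightarrow> bipoly \<Rightarrow> real" where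
  "moment_int \<alpha> \<gamma> \<kappa> f = (LINT (x, y):triangle|lborel. eval f x y * weight \<alpha> \<gamma> \<kappa> x y)"

lemma orth_iff: "orth \<alpha> \<gamma> \<kappa> p q \<longleftrightarrow> moment_int \<alpha> \<gamma> \<kappa> (p * q) = 0"
  by (simp add: orth_def moment_int_def)

section \<open>Beta integrals and integration in the coordinates s and u\<close>

lemma nn_integral_Beta:
  fixes a b :: real
  assumes "a > 0" "b > 0"
  shows "(\<integral>\<^sup>+t. ennreal (indicator {0..1} t * (t powr (a - 1) * (1 - t) powr (b - 1))) \<partial>lborel)
    = ennreal (Beta a b)"
proof (rule nn_integral_has_integral_lborel)
  show "((\<lambda>t. indicator {0..1} t * (t powr (a - 1) * (1 - t) powr (b - 1))) has_integral Beta a b) UNIV"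
  proof -
    have "(\<lambda>t. indicator {0..1} t * (t powr (a - 1) * (1 - t) powr (b - 1))) =
        (\<lambda>t. if t \<in> {0..1} then t powr (a - 1) * (1 - t) powr (b - 1) else 0)"
      by (auto simp: fun_eq_iff)
    then show ?thesis
      using has_integral_Beta_real[OF assms] by (simp only: has_integral_restrict_UNIV)
  qed
qed auto

text \<open>Substitute t = u^2 in Euler's Beta integral. This is the form in which the integral over
  u appears, with u = (x - y)/(x + y).\<close>

lemma nn_integral_Beta_square:
  fixes a b :: real
  assumes "a > 0" "b > 0"
  shows "(\<integral>\<^sup>+u. ennreal (indicator {0<..<1} u * (u powr (2 * a - 1) * (1 - u\<^sup>2) powr (b - 1))) \<partial>lborel)
    = ennreal (Beta a b / 2)"
proof -
  let ?I = "\<integral>\<^sup>+u. ennreal (indicator {0<..<1} u * (u powr (2 * a - 1) * (1 - u\<^sup>2) powr (b - 1))) \<partial>lborel"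
  let ?f = "\<lambda>t::real. t powr (a - 1) * (1 - t) powr (b - 1)"
  have "ennreal (Beta a b) = (\<integral>\<^sup>+t. ennreal (?f t * indicator {0\<^sup>2..1\<^sup>2} t) \<partial>lborel)"
    using nn_integral_Beta[OF assms] by (simp add: mult.commute)
  also have "\<dots> = (\<integral>\<^sup>+u. ennreal (?f (u\<^sup>2) * (2 * u) * indicator {0..1} u) \<partial>lborel)"
    by (rule nn_integral_substitution)
      (auto intro!: derivative_eq_intros continuous_intros simp: set_borel_measurable_def)
  also have "\<dots> = (\<integral>\<^sup>+u. ennreal 2 * ennreal (indicator {0<..<1} u
      * (u powr (2 * a - 1) * (1 - u\<^sup>2) powr (b - 1))) \<partial>lborel)"
  proof (intro nn_integral_cong)
    fix u :: real
    have "(u\<^sup>2) powr (a - 1) * u = u powr (2 * a - 1)" if "0 < u"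
    proof -
      have "(u\<^sup>2) powr (a - 1) = u powr (2 * (a - 1))"
        using that by (simp add: powr_powr flip: powr_numeral)
      then show ?thesis
        using that powr_add[of u "2 * (a - 1)" 1] by (simp add: algebra_simps)
    qed
    \<comment> \<open>Passing to the open interval changes no value: at u = 0 the factor 2u
      vanishes, and at u = 1 the factor \<open>0 powr (b - 1)\<close> is 0.\<close>
    then show "ennreal (?f (u\<^sup>2) * (2 * u) * indicator {0..1} u) = ennreal 2 * ennreal
        (indicator {0<..<1} u * (u powr (2 * a - 1) * (1 - u\<^sup>2) powr (b - 1)))"
      by (auto simp: indicator_def ennreal_mult'[symmetric] mult_ac simp del: ennreal_numeral)
  qed
  also have "\<dots> = ennreal 2 * ?I"
    by (rule nn_integral_cmult) measurable
  finally have "ennreal (1 / 2) * ennreal (Beta a b) = ennreal (1 / 2) * (ennreal 2 * ?I)"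
    by simp
  also have "\<dots> = ?I"
    by (simp add: mult.assoc[symmetric] ennreal_mult'[symmetric] del: ennreal_numeral ennreal_half)
  finally show ?thesis
    by (simp add: ennreal_mult'[symmetric] del: ennreal_numeral ennreal_half)
qed

lemma nn_integral_sum_difference:
  fixes F :: "real \<times> real \<Rightarrow> ennreal"
  assumes [measurable]: "F \<in> borel_measurable (lborel \<Otimes>\<^sub>M lborel)"
    and supp: "\<And>x y. \<not> 0 < x + y \<Longrightarrow> F (x, y) = 0"
  shows "(\<integral>\<^sup>+z. F z \<partial>lborel) =
    (\<integral>\<^sup>+s. \<integral>\<^sup>+u. ennreal (s / 2) * F (s * (1 + u) / 2, s * (1 - u) / 2) \<partial>lborel \<partial>lborel)"
proof -
  have "(\<integral>\<^sup>+z. F z \<partial>lborel) = (\<integral>\<^sup>+x. \<integral>\<^sup>+y. F (x, y) \<partial>lborel \<partial>lborel)"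
    by (simp add: lborel_prod[symmetric] lborel.nn_integral_fst)
  also have "\<dots> = (\<integral>\<^sup>+x. \<integral>\<^sup>+s. F (x, s - x) \<partial>lborel \<partial>lborel)"
  proof (rule nn_integral_cong)
    fix x :: real
    show "(\<integral>\<^sup>+y. F (x, y) \<partial>lborel) = (\<integral>\<^sup>+s. F (x, s - x) \<partial>lborel)"
      using nn_integral_real_affine[of "\<lambda>y. F (x, y)" 1 "- x"] by simp
  qed
  also have "\<dots> = (\<integral>\<^sup>+s. \<integral>\<^sup>+x. F (x, s - x) \<partial>lborel \<partial>lborel)"
    by (rule lborel_pair.Fubini'[symmetric]) measurable
  also have "\<dots> = (\<integral>\<^sup>+s. \<integral>\<^sup>+u. ennreal (s / 2) * F (s * (1 + u) / 2, s * (1 - u) / 2) \<partial>lborel \<partial>lborel)"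
  proof (rule nn_integral_cong)
    fix s :: real
    show "(\<integral>\<^sup>+x. F (x, s - x) \<partial>lborel) =
        (\<integral>\<^sup>+u. ennreal (s / 2) * F (s * (1 + u) / 2, s * (1 - u) / 2) \<partial>lborel)"
    proof (cases "s > 0")
      case True
      have "(\<integral>\<^sup>+x. F (x, s - x) \<partial>lborel) =
          ennreal (s / 2) * (\<integral>\<^sup>+u. F (s / 2 + s / 2 * u, s - (s / 2 + s / 2 * u)) \<partial>lborel)"
        using True nn_integral_real_affine[of "\<lambda>x. F (x, s - x)" "s / 2" "s / 2"] by simp
      also have "\<dots> = (\<integral>\<^sup>+u. ennreal (s / 2) * F (s / 2 + s / 2 * u, s - (s / 2 + s / 2 * u)) \<partial>lborel)"
        by (rule nn_integral_cmult[symmetric]) measurable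
      also have "\<dots> = (\<integral>\<^sup>+u. ennreal (s / 2) * F (s * (1 + u) / 2, s * (1 - u) / 2) \<partial>lborel)"
        by (simp add: algebra_simps add_divide_distrib diff_divide_distrib)
      finally show ?thesis .
    next
      case False
      then show ?thesis by (simp add: supp ennreal_neg)
    qed
  qed
  finally show ?thesis .
qed

text \<open>Closed form of the integral of a monomial. The first Beta value is the integral over s,
  with 2\<alpha> + 2\<kappa> + 1 powers of s from the weight and one from the Jacobian; the second
  is the integral over u. The power of 4 collects the 1/4 in xy = s^2(1 - u^2)/4, the Jacobian's 1/2
  and the 1/2 of \<open>nn_integral_Beta_square\<close>.\<close>

definition moment :: "real \<Rightarrow> real \<Rightarrow> real \<Rightarrow> nat \<times> nat \<Rightarrow> real" where
  "moment \<alpha> \<gamma> \<kappa> i = Beta (real (fst i + 2 * snd i) + 2 * \<alpha> + 2 * \<kappa> + 3) (\<gamma> + 1)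
     * Beta (\<kappa> + 1) (\<alpha> + real (snd i) + 1) / 4 powr (\<alpha> + real (snd i) + 1)"

lemma measurable_triangle [measurable]: "triangle \<in> sets borel"
proof -
  have "{z \<in> space (borel \<Otimes>\<^sub>M borel). 0 \<le> fst z \<and> 0 \<le> snd z \<and> fst z + snd z \<le> 1 \<and> snd z < fst z}
      \<in> sets (borel \<Otimes>\<^sub>M borel :: (real \<times> real) measure)"
    by measurable
  also have "{z \<in> space (borel \<Otimes>\<^sub>M borel). 0 \<le> fst z \<and> 0 \<le> snd z \<and> fst z + snd z \<le> 1 \<and> snd z < fst z}
      = triangle"
    by (auto simp: triangle_def simplex2_def space_pair_measure)
  finally show ?thesis unfolding borel_prod .
qed

lemma measurable_weight [measurable]:
  "(\<lambda>z. weight \<alpha> \<gamma> \<kappa> (fst z) (snd z)) \<in> borel_measurable borel"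
  unfolding weight_def borel_prod[symmetric] by measurable

lemma measurable_sym_mon [measurable]:
  "(\<lambda>z. eval (sym_mon i) (fst z) (snd z)) \<in> borel_measurable borel"
  unfolding sym_mon_def eval_simps borel_prod[symmetric] by measurable

text \<open>The variables separate because x + y = s, xy = s^2(1 - u^2)/4 and x - y = su. Exponents
  are left in the form e - 1 to match the Beta integrals.\<close>

lemma sym_mon_integrand_polar:
  assumes "0 < s"
  shows "s / 2 * (indicator triangle (s * (1 + u) / 2, s * (1 - u) / 2) *
       (eval (sym_mon (n, k)) (s * (1 + u) / 2) (s * (1 - u) / 2)
        * weight \<alpha> \<gamma> \<kappa> (s * (1 + u) / 2) (s * (1 - u) / 2)))
    = (1 / (2 * 4 powr (\<alpha> + real k)) * (indicator {0..1} s *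
        (s powr (real (n + 2 * k) + 2 * \<alpha> + 2 * \<kappa> + 3 - 1) * (1 - s) powr (\<gamma> + 1 - 1)))) *
      (indicator {0<..<1} u * (u powr (2 * (\<kappa> + 1) - 1) * (1 - u\<^sup>2) powr (\<alpha> + real k + 1 - 1)))"
proof (cases "s \<le> 1 \<and> 0 < u \<and> u < 1")
  case True
  define x where "x = s * (1 + u) / 2"
  define y where "y = s * (1 - u) / 2"
  have u2: "1 - u\<^sup>2 > 0" using True by (simp add: power_less_one_iff)
  have xy: "x * y = s\<^sup>2 * (1 - u\<^sup>2) / 4" "x + y = s" "x - y = s * u"
    by (auto simp: x_def y_def field_simps power2_eq_square)
  have "0 < x * y" using assms u2 by (simp add: xy)
  have T: "(x, y) \<in> triangle"
    using True assms xy(2,3) by (auto simp: triangle_def simplex2_def x_def y_def)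
  have sq: "(s\<^sup>2) powr c = s powr (2 * c)" for c
    using assms by (simp add: powr_powr flip: powr_numeral)
  have "(x * y) ^ k * (x * y) powr \<alpha> = (x * y) powr (\<alpha> + real k)"
    using \<open>0 < x * y\<close> by (simp add: powr_add powr_realpow)
  also have "\<dots> = s powr (2 * (\<alpha> + real k)) * (1 - u\<^sup>2) powr (\<alpha> + real k) / 4 powr (\<alpha> + real k)"
    using assms u2 unfolding xy
    by (simp add: powr_divide powr_mult sq)
  finally have 1: "(x * y) ^ k * (x * y) powr \<alpha> = \<dots>" .
  have 2: "\<bar>x - y\<bar> powr (2 * \<kappa> + 1) = s powr (2 * \<kappa> + 1) * u powr (2 * \<kappa> + 1)"
    unfolding xy using assms True by (simp add: powr_mult abs_mult)
  have "s * (s ^ n * (s powr (2 * (\<alpha> + real k)) * s powr (2 * \<kappa> + 1)))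
      = s powr (1 + (real n + (2 * (\<alpha> + real k) + (2 * \<kappa> + 1))))"
    using assms by (simp add: powr_add powr_realpow power2_eq_square)
  also have "\<dots> = s powr (real (n + 2 * k) + 2 * \<alpha> + 2 * \<kappa> + 3 - 1)"
    by (rule arg_cong[where f = "\<lambda>e. s powr e"]) simp
  finally have 3: "s powr (real (n + 2 * k) + 2 * \<alpha> + 2 * \<kappa> + 3 - 1) =
      s * (s ^ n * (s powr (2 * (\<alpha> + real k)) * s powr (2 * \<kappa> + 1)))" ..
  have "eval (sym_mon (n, k)) x y * weight \<alpha> \<gamma> \<kappa> x y =
      s ^ n * ((x * y) ^ k * (x * y) powr \<alpha>) * (1 - s) powr \<gamma> * \<bar>x - y\<bar> powr (2 * \<kappa> + 1)"
    by (simp add: sym_mon_def weight_def xy(2) algebra_simps flip: xy(2))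
  then have 4: "eval (sym_mon (n, k)) x y * weight \<alpha> \<gamma> \<kappa> x y =
      s ^ n * (s powr (2 * (\<alpha> + real k)) * (1 - u\<^sup>2) powr (\<alpha> + real k) / 4 powr (\<alpha> + real k))
       * (1 - s) powr \<gamma> * (s powr (2 * \<kappa> + 1) * u powr (2 * \<kappa> + 1))"
    unfolding 1 2 .
  show ?thesis
    unfolding x_def[symmetric] y_def[symmetric] 4 3 using True T assms by (simp add: add.commute)
next
  case False
  \<comment> \<open>The edge y = 0, that is u = 1, belongs to \<open>triangle\<close>, but the
    weight is 0 there because \<open>0 powr \<alpha>\<close> is 0.\<close>
  have "(s * (1 + u) / 2, s * (1 - u) / 2) \<notin> triangle \<or> u = 1"
  proof (rule ccontr)
    assume "\<not> ?thesis"
    then have "0 \<le> s * (1 - u)" "s * (1 - u) < s * (1 + u)" "s \<le> 1" "u \<noteq> 1"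
      by (auto simp: triangle_def simplex2_def field_simps)
    then show False using False assms by (auto simp: zero_le_mult_iff)
  qed
  then show ?thesis using False assms
    by (auto simp: indicator_def weight_def)
qed

text \<open>Working with nonnegative integrals gives the value by Tonelli and, since it is finite,
  integrability as well.\<close>

lemma nn_integral_sym_mon:
  assumes "\<alpha> > -1" "\<gamma> > -1" "\<kappa> > -1" "\<alpha> + \<kappa> > - 3 / 2"
  shows "(\<integral>\<^sup>+z. ennreal (indicator triangle z * (eval (sym_mon i) (fst z) (snd z)
      * weight \<alpha> \<gamma> \<kappa> (fst z) (snd z))) \<partial>lborel) = ennreal (moment \<alpha> \<gamma> \<kappa> i)"
proof -
  obtain n k where i: "i = (n, k)" by (cases i)
  let ?F = "\<lambda>z. ennreal (indicator triangle z * (eval (sym_mon i) (fst z) (snd z)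
      * weight \<alpha> \<gamma> \<kappa> (fst z) (snd z)))"
  let ?a = "real (n + 2 * k) + 2 * \<alpha> + 2 * \<kappa> + 3"
  let ?A = "\<lambda>s. indicator {0..1} s * (s powr (?a - 1) * (1 - s) powr (\<gamma> + 1 - 1))"
  let ?U = "\<lambda>u. indicator {0<..<1} u * (u powr (2 * (\<kappa> + 1) - 1) * (1 - u\<^sup>2) powr (\<alpha> + real k + 1 - 1))"
  let ?c = "1 / (2 * 4 powr (\<alpha> + real k))"
  let ?B = "Beta (\<kappa> + 1) (\<alpha> + real k + 1) / 2"
  have [measurable]: "?F \<in> borel_measurable borel"
    by measurable
  \<comment> \<open>The first Beta parameter is smallest at n = k = 0, where its positivity is the
    condition \<alpha> + \<kappa> > -3/2.\<close>
  have pos: "?a > 0" using assms by linarith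
  have "(\<integral>\<^sup>+z. ?F z \<partial>lborel) = (\<integral>\<^sup>+s. \<integral>\<^sup>+u. ennreal (s / 2) * ?F (s * (1 + u) / 2, s * (1 - u) / 2) \<partial>lborel \<partial>lborel)"
  proof (rule nn_integral_sum_difference)
    show "?F \<in> borel_measurable (lborel \<Otimes>\<^sub>M lborel)"
      unfolding lborel_prod by simp
  qed (auto simp: triangle_def simplex2_def indicator_def)
  also have "\<dots> = (\<integral>\<^sup>+s. \<integral>\<^sup>+u. ennreal (?c * ?A s) * ennreal (?U u) \<partial>lborel \<partial>lborel)"
  proof (intro nn_integral_cong)
    fix s u :: real
    show "ennreal (s / 2) * ?F (s * (1 + u) / 2, s * (1 - u) / 2) = ennreal (?c * ?A s) * ennreal (?U u)"
    proof (cases "0 < s")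
      case True
      have "ennreal (s / 2) * ?F (s * (1 + u) / 2, s * (1 - u) / 2) = ennreal (s / 2 *
          (indicator triangle (s * (1 + u) / 2, s * (1 - u) / 2) *
            (eval (sym_mon (n, k)) (s * (1 + u) / 2) (s * (1 - u) / 2)
              * weight \<alpha> \<gamma> \<kappa> (s * (1 + u) / 2) (s * (1 - u) / 2))))"
        unfolding i fst_conv snd_conv by (rule ennreal_mult'[symmetric]) (use True in simp)
      also have "\<dots> = ennreal (?c * ?A s * ?U u)"
        by (simp only: sym_mon_integrand_polar[OF True])
      also have "\<dots> = ennreal (?c * ?A s) * ennreal (?U u)"
        by (rule ennreal_mult'') simp
      finally show ?thesis .
    next
      case False
      \<comment> \<open>At s = 0 the indicator on the right is 1, but the power of s is
        \<open>0 powr _\<close>, hence 0.\<close>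
      then show ?thesis by (auto simp: ennreal_neg indicator_def)
    qed
  qed
  also have "\<dots> = (\<integral>\<^sup>+s. ennreal (?c * ?A s) * ennreal ?B \<partial>lborel)"
    using assms nn_integral_Beta_square[of "\<kappa> + 1" "\<alpha> + real k + 1"]
    by (simp add: nn_integral_cmult)
  also have "\<dots> = (\<integral>\<^sup>+s. ennreal (?c * ?B) * ennreal (?A s) \<partial>lborel)"
    by (intro nn_integral_cong) (simp add: ennreal_mult'[symmetric] ennreal_mult''[symmetric] Beta_def mult_ac)
  also have "\<dots> = ennreal (?c * ?B) * ennreal (Beta ?a (\<gamma> + 1))"
    using assms nn_integral_Beta[OF pos, of "\<gamma> + 1"] by (simp add: nn_integral_cmult)
  also have "\<dots> = ennreal (?c * ?B * Beta ?a (\<gamma> + 1))"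
    using assms by (intro ennreal_mult'[symmetric]) (simp add: Beta_def Gamma_real_pos less_imp_le)
  also have "?c * ?B * Beta ?a (\<gamma> + 1) = moment \<alpha> \<gamma> \<kappa> i"
    by (simp add: i moment_def powr_add mult_ac)
  finally show ?thesis .
qed

section \<open>Integrability of the monomials and the moment recurrence\<close>

definition integrand :: "real \<Rightarrow> real \<Rightarrow> real \<Rightarrow> bipoly \<Rightarrow> real \<times> real \<Rightarrow> real" where
  "integrand \<alpha> \<gamma> \<kappa> f z = indicator triangle z * (eval f (fst z) (snd z) * weight \<alpha> \<gamma> \<kappa> (fst z) (snd z))"

lemma moment_int_eq: "moment_int \<alpha> \<gamma> \<kappa> f = (LINT z|lborel. integrand \<alpha> \<gamma> \<kappa> f z)"
  by (simp add: moment_int_def set_lebesgue_integral_def integrand_def case_prod_unfold)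

lemma
  assumes "\<alpha> > -1" "\<gamma> > -1" "\<kappa> > -1" "\<alpha> + \<kappa> > - 3 / 2"
  shows integrable_sym_mon: "integrable lborel (integrand \<alpha> \<gamma> \<kappa> (sym_mon i))"
    and moment_int_sym_mon: "moment_int \<alpha> \<gamma> \<kappa> (sym_mon i) = moment \<alpha> \<gamma> \<kappa> i"
proof -
  have m: "integrand \<alpha> \<gamma> \<kappa> (sym_mon i) \<in> borel_measurable lborel"
    unfolding integrand_def by measurable
  \<comment> \<open>On \<open>triangle\<close> both x + y and xy are nonnegative, so the finite
    nonnegative integral is also the Lebesgue integral.\<close>
  have nonneg: "integrand \<alpha> \<gamma> \<kappa> (sym_mon i) z \<ge> 0" for z
    by (auto simp: integrand_def indicator_def triangle_def simplex2_def weight_def sym_mon_def)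
  have I: "(\<integral>\<^sup>+z. ennreal (integrand \<alpha> \<gamma> \<kappa> (sym_mon i) z) \<partial>lborel) = ennreal (moment \<alpha> \<gamma> \<kappa> i)"
    unfolding integrand_def by (rule nn_integral_sym_mon[OF assms])
  have "0 < real (fst i + 2 * snd i) + 2 * \<alpha> + 2 * \<kappa> + 3" using assms by linarith
  then have "moment \<alpha> \<gamma> \<kappa> i \<ge> 0"
    using assms by (auto simp: moment_def Beta_def Gamma_real_pos less_imp_le)
  then have "has_bochner_integral lborel (integrand \<alpha> \<gamma> \<kappa> (sym_mon i)) (moment \<alpha> \<gamma> \<kappa> i)"
    using m nonneg I by (intro has_bochner_integral_nn_integral) auto
  then show "integrable lborel (integrand \<alpha> \<gamma> \<kappa> (sym_mon i))"
    "moment_int \<alpha> \<gamma> \<kappa> (sym_mon i) = moment \<alpha> \<gamma> \<kappa> i"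
    by (auto simp: has_bochner_integral_iff moment_int_eq)
qed

text \<open>The two indices have the same weighted degree n + 2 + 2k, so the integrals over s agree.
  What remains is (a + b) B(a, b + 1) = b B(a, b) with a = \<kappa> + 1 and b = \<alpha> + k + 1;
  the 4 comes from the power of 4.\<close>

lemma moment_rec:
  assumes "\<alpha> > -1"
  shows "(real k + \<alpha> + 1) * moment \<alpha> \<gamma> \<kappa> (n + 2, k) = 4 * (real k + \<kappa> + \<alpha> + 2) * moment \<alpha> \<gamma> \<kappa> (n, Suc k)"
proof -
  have "\<alpha> + real k + 1 \<notin> \<int>\<^sub>\<le>\<^sub>0" using assms by (auto elim!: nonpos_Ints_cases')
  from Beta_plus1_right[OF this, of "\<kappa> + 1"]
  have B: "(real k + \<kappa> + \<alpha> + 2) * Beta (\<kappa> + 1) (\<alpha> + real (Suc k) + 1)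
      = (real k + \<alpha> + 1) * Beta (\<kappa> + 1) (\<alpha> + real k + 1)"
    by (simp add: algebra_simps)
  have "(4::real) powr (\<alpha> + real (Suc k) + 1) = 4 * 4 powr (\<alpha> + real k + 1)"
    by (simp add: powr_add)
  moreover have "n + 2 + 2 * k = n + 2 * Suc k" by simp
  ultimately have "4 * (real k + \<kappa> + \<alpha> + 2) * moment \<alpha> \<gamma> \<kappa> (n, Suc k) =
      Beta (real (n + 2 + 2 * k) + 2 * \<alpha> + 2 * \<kappa> + 3) (\<gamma> + 1)
      * ((real k + \<kappa> + \<alpha> + 2) * Beta (\<kappa> + 1) (\<alpha> + real (Suc k) + 1)) / 4 powr (\<alpha> + real k + 1)"
    unfolding moment_def fst_conv snd_conv by (simp only:) (simp add: field_simps del: of_nat_Suc of_nat_add)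
  then show ?thesis
    unfolding B by (simp add: moment_def)
qed

section \<open>The span of the symmetric monomials\<close>

lemma sym_mon_add: "sym_mon i * sym_mon j = sym_mon (i + j)"
  by (simp add: sym_mon_def power_add mult_ac)

text \<open>Makes span induction available, so that linear claims need checking on monomials
  only.\<close>

interpretation bp: vector_space scale
proof
  fix a b :: real and f :: bipoly
  have "[:a + b:] = [:a:] + [:b:]" by simp
  then show "scale (a + b) f = scale a f + scale b f"
    by (simp only: scale_def smult_add_left)
qed (simp_all add: scale_def smult_add_right mult.commute flip: one_pCons)

text \<open>As a set this is the space of all symmetric polynomials; the span form provides the
  induction principle.\<close>

definition sym_span :: "bipoly set" where
  "sym_span = bp.span (range sym_mon)"

text \<open>Zero together with the polynomials of symmetric degree preceding j.\<close>

definition below :: "nat \<times> nat \<Rightarrow> bipoly set" where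
  "below j = bp.span (sym_mon ` {i. i \<prec>\<^sub>d j})"

lemma sym_mon_in_sym_span: "sym_mon i \<in> sym_span"
  by (simp add: sym_span_def bp.span_base)

lemma below_subset: "f \<in> below j \<Longrightarrow> f \<in> sym_span"
  unfolding below_def sym_span_def by (rule bp.span_mono[THEN subsetD]) auto

lemma sym_span_mult:
  assumes "f \<in> sym_span" "g \<in> sym_span"
  shows "f * g \<in> sym_span"
proof -
  have 1: "sym_mon i * g \<in> sym_span" if "g \<in> sym_span" for i g
    using that unfolding sym_span_def
  proof (induction rule: bp.span_induct_alt)
    case base
    then show ?case by (simp add: bp.span_zero)
  next
    case (step c x y)
    then obtain j where "x = sym_mon j" by auto
    then have "sym_mon i * (scale c x + y) = scale c (sym_mon (i + j)) + sym_mon i * y"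
      by (simp add: algebra_simps scale_def flip: sym_mon_add)
    then show ?case
      using step by (simp add: bp.span_add bp.span_scale bp.span_base)
  qed
  show ?thesis
    using assms(1) unfolding sym_span_def
  proof (induction rule: bp.span_induct_alt)
    case base
    then show ?case by (simp add: bp.span_zero)
  next
    case (step c x y)
    then obtain j where "x = sym_mon j" by auto
    then have "(scale c x + y) * g = scale c (sym_mon j * g) + y * g"
      by (simp add: algebra_simps scale_def)
    then show ?case
      using step 1[OF assms(2)] by (simp add: bp.span_add bp.span_scale sym_span_def)
  qed
qed

lemma sym_poly_sym_span:
  assumes "f \<in> sym_span" shows "sym_poly f"
  using assms unfolding sym_span_def
proof (induction rule: bp.span_induct_alt)
  case base
  then show ?case by (simp add: sym_poly_def)
next
  case (step c x y)
  then show ?case by (auto simp: sym_poly_def sym_mon_def add.commute mult.commute)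
qed

lemma sym_span_linear:
  "0 \<in> sym_span"
  "f \<in> sym_span \<Longrightarrow> g \<in> sym_span \<Longrightarrow> f + g \<in> sym_span"
  "f \<in> sym_span \<Longrightarrow> g \<in> sym_span \<Longrightarrow> f - g \<in> sym_span"
  "f \<in> sym_span \<Longrightarrow> scale c f \<in> sym_span"
  by (auto simp: sym_span_def bp.span_zero bp.span_add bp.span_diff bp.span_scale)

lemma below_linear:
  "0 \<in> below j"
  "f \<in> below j \<Longrightarrow> g \<in> below j \<Longrightarrow> f + g \<in> below j"
  "f \<in> below j \<Longrightarrow> g \<in> below j \<Longrightarrow> f - g \<in> below j"
  "f \<in> below j \<Longrightarrow> scale c f \<in> below j"
  by (auto simp: below_def bp.span_zero bp.span_add bp.span_diff bp.span_scale)

lemma sym_mon_in_below: "i \<prec>\<^sub>d j \<Longrightarrow> sym_mon i \<in> below j"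
  by (auto simp: below_def intro: bp.span_base)

section \<open>Positive definiteness and orthogonal projection\<close>

lemma integrand_linear:
  "integrand \<alpha> \<gamma> \<kappa> 0 z = 0"
  "integrand \<alpha> \<gamma> \<kappa> (f + g) z = integrand \<alpha> \<gamma> \<kappa> f z + integrand \<alpha> \<gamma> \<kappa> g z"
  "integrand \<alpha> \<gamma> \<kappa> (f - g) z = integrand \<alpha> \<gamma> \<kappa> f z - integrand \<alpha> \<gamma> \<kappa> g z"
  "integrand \<alpha> \<gamma> \<kappa> (scale c f) z = c * integrand \<alpha> \<gamma> \<kappa> f z"
  by (simp_all add: integrand_def algebra_simps)

lemma continuous_eval: "continuous_on UNIV (\<lambda>z. eval f (fst z) (snd z))"
proof (induction f)
  case 0
  then show ?case by simp
next
  case (pCons a f)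
  have "continuous_on UNIV (\<lambda>z::real \<times> real. poly a (fst z) + snd z * eval f (fst z) (snd z))"
    using pCons.IH by (intro continuous_intros continuous_on_poly) auto
  then show ?case by (simp add: eval_def)
qed

lemma bipoly_eq_0_triangle:
  assumes "\<And>x y. 0 < y \<Longrightarrow> y < x \<Longrightarrow> x + y < 1 \<Longrightarrow> eval f x y = 0"
  shows "f = 0"
proof (rule ccontr)
  assume "f \<noteq> 0"
  then have "finite {c. poly f c = 0}" by (rule poly_roots_finite)
  \<comment> \<open>For y < 1/2 the slice y < x < 1 - y is a nonempty interval, so f, as a
    polynomial in its outer variable, has infinitely many constant roots.\<close>
  moreover have "(\<lambda>y. [:y:]) ` {0<..<1/2::real} \<subseteq> {c. poly f c = 0}"
  proof safe
    fix y :: real assume "y \<in> {0<..<1/2}"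
    then show "poly f [:y:] = 0"
      using poly_eq_0_on_interval[of y "1 - y" "poly f [:y:]"] assms
      by (simp add: eval_def)
  qed
  ultimately have "finite ((\<lambda>y. [:y:]) ` {0<..<1/2::real})" using finite_subset by blast
  then have "finite {0<..<1/2::real}" by (rule finite_imageD) (simp add: inj_on_def)
  then show False by (simp add: infinite_Ioo)
qed

text \<open>Such parameters make the weight integrable on the triangle.\<close>

locale weight_parameters =
  fixes \<alpha> \<gamma> \<kappa> :: real
  assumes params: "\<alpha> > -1" "\<gamma> > -1" "\<kappa> > -1" "\<alpha> + \<kappa> > - 3 / 2"
begin

abbreviation L :: "bipoly \<Rightarrow> real" where
  "L \<equiv> moment_int \<alpha> \<gamma> \<kappa>"

lemma integrable_sym_span:
  assumes "f \<in> sym_span" shows "integrable lborel (integrand \<alpha> \<gamma> \<kappa> f)"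
  using assms unfolding sym_span_def
proof (induction rule: bp.span_induct_alt)
  case base
  then show ?case by (simp add: integrand_linear)
next
  case (step c x y)
  then show ?case using integrable_sym_mon[OF params] by (auto simp: integrand_linear)
qed

lemma L_linear:
  "L 0 = 0"
  "f \<in> sym_span \<Longrightarrow> g \<in> sym_span \<Longrightarrow> L (f + g) = L f + L g"
  "f \<in> sym_span \<Longrightarrow> g \<in> sym_span \<Longrightarrow> L (f - g) = L f - L g"
  "L (scale c f) = c * L f"
  by (simp_all add: moment_int_eq integrand_linear integrable_sym_span)

text \<open>Positive definiteness: a nonnegative integrand with zero integral vanishes almost
  everywhere, the weight is nonzero on the open triangle, and the set there where f is nonzero is
  open. An open null set is empty, so f vanishes on the open triangle.\<close>

lemma L_square_eq_0:
  assumes "f \<in> sym_span" "L (f * f) = 0"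
  shows "f = 0"
proof (rule bipoly_eq_0_triangle)
  let ?T = "{z::real \<times> real. 0 < snd z \<and> snd z < fst z \<and> fst z + snd z < 1}"
  let ?U = "?T \<inter> {z. eval f (fst z) (snd z) \<noteq> 0}"
  have "AE z in lborel. integrand \<alpha> \<gamma> \<kappa> (f * f) z = 0"
  proof (subst integral_nonneg_eq_0_iff_AE[symmetric])
    show "integrable lborel (integrand \<alpha> \<gamma> \<kappa> (f * f))"
      by (intro integrable_sym_span sym_span_mult assms)
    show "AE z in lborel. 0 \<le> integrand \<alpha> \<gamma> \<kappa> (f * f) z"
      by (simp add: integrand_def weight_def)
  qed (use assms in \<open>simp add: moment_int_eq\<close>)
  then have "AE z in lborel. z \<notin> ?U"
  proof (rule AE_mp, intro AE_I2 impI notI)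
    fix z assume *: "integrand \<alpha> \<gamma> \<kappa> (f * f) z = 0" "z \<in> ?U"
    then have "z \<in> triangle" by (auto simp: triangle_def simplex2_def)
    moreover have "weight \<alpha> \<gamma> \<kappa> (fst z) (snd z) \<noteq> 0" using *(2) by (auto simp: weight_def)
    ultimately show False using * by (simp add: integrand_def)
  qed
  moreover have open_U: "open ?U"
  proof (intro open_Int open_Collect_conj open_Collect_less open_Collect_neq continuous_eval)
  qed (auto intro!: continuous_intros)
  ultimately have "?U \<in> null_sets lborel"
    by (subst (asm) AE_iff_null_sets[symmetric]) auto
  then have "negligible ?U"
    by (simp add: negligible_iff_null_sets null_sets_completionI)
  then have "?U = {}" using open_U open_not_negligible by blast
  then show "eval f x y = 0" if "0 < y" "y < x" "x + y < 1" for x y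
    using that by (auto simp: set_eq_iff)
qed

lemma L_orthogonal_span:
  assumes h: "h \<in> sym_span" and perp: "\<And>i. i \<in> S \<Longrightarrow> L (h * sym_mon i) = 0"
    and q: "q \<in> bp.span (sym_mon ` S)"
  shows "L (h * q) = 0"
proof -
  from q have "q \<in> sym_span \<and> L (h * q) = 0"
  proof (induction rule: bp.span_induct_alt)
    case base
    then show ?case by (simp add: L_linear sym_span_linear)
  next
    case (step c x y)
    then obtain i where x: "x = sym_mon i" "i \<in> S" by auto
    have "h * (scale c x + y) = scale c (h * x) + h * y"
      by (simp add: algebra_simps scale_def)
    then show ?case
      using step h perp x by (simp add: L_linear sym_span_mult sym_span_linear sym_mon_in_sym_span)
  qed
  then show ?thesis ..
qed

text \<open>Gram-Schmidt by induction on the index set. The hypothesis is used for f and for the new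
  monomial; the residual h of the latter is orthogonal to the old span, so adding a multiple of h to
  g corrects the pairing with the new monomial and leaves the old ones unchanged.\<close>

lemma orthogonal_projection:
  assumes "finite S" "f \<in> sym_span"
  shows "\<exists>g \<in> bp.span (sym_mon ` S). \<forall>i\<in>S. L ((f - g) * sym_mon i) = 0"
  using assms
proof (induction S arbitrary: f rule: finite_induct)
  case empty
  then show ?case by (auto intro: bp.span_zero)
next
  case (insert j S)
  have span_sub: "g \<in> sym_span" if "g \<in> bp.span (sym_mon ` A)" for g A
    using that bp.span_mono[of "sym_mon ` A" "range sym_mon"] by (auto simp: sym_span_def)
  have mono: "g \<in> bp.span (sym_mon ` insert j S)" if "g \<in> bp.span (sym_mon ` S)" for g
    using that bp.span_mono[of "sym_mon ` S" "sym_mon ` insert j S"] by auto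
  obtain g where g: "g \<in> bp.span (sym_mon ` S)" "\<And>i. i \<in> S \<Longrightarrow> L ((f - g) * sym_mon i) = 0"
    using insert.IH[OF insert.prems] by blast
  obtain r where r: "r \<in> bp.span (sym_mon ` S)" "\<And>i. i \<in> S \<Longrightarrow> L ((sym_mon j - r) * sym_mon i) = 0"
    using insert.IH[OF sym_mon_in_sym_span] by blast
  define h where "h = sym_mon j - r"
  have h: "h \<in> bp.span (sym_mon ` insert j S)"
    unfolding h_def by (intro bp.span_diff bp.span_base mono r) auto
  have h_sym: "h \<in> sym_span" and fg_sym: "f - g \<in> sym_span"
    using span_sub[OF h] span_sub[OF g(1)] insert.prems by (auto intro: sym_span_linear)
  have perp: "L (h * q) = 0" if "q \<in> bp.span (sym_mon ` S)" for q
    using L_orthogonal_span[OF h_sym _ that] r(2) by (simp add: h_def)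
  have hj: "L (h * sym_mon j) = L (h * h)"
  proof -
    have "h * sym_mon j = h * h + h * r" by (simp add: h_def algebra_simps)
    then show ?thesis
      using perp[OF r(1)] h_sym span_sub[OF r(1)] by (simp add: L_linear sym_span_mult)
  qed
  \<comment> \<open>By \<open>hj\<close> this is the coefficient for which subtracting
    \<open>scale c h\<close> makes the residual orthogonal to \<open>sym_mon j\<close>.\<close>
  define c where "c = L ((f - g) * sym_mon j) / L (h * h)"
  have cj: "L ((f - g) * sym_mon j) = c * L (h * h)"
  proof (cases "L (h * h) = 0")
    \<comment> \<open>Definiteness gives h = 0, so the new monomial equals r and lies in the old
      span, to which f - g is already orthogonal.\<close>
    case True
    then have "sym_mon j = r" using L_square_eq_0[OF h_sym] by (simp add: h_def)
    have "L ((f - g) * r) = 0"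
      using L_orthogonal_span[OF fg_sym _ r(1)] g(2) by simp
    then show ?thesis using True \<open>sym_mon j = r\<close> by simp
  qed (simp add: c_def)
  show ?case
  proof (intro bexI ballI)
    show "g + scale c h \<in> bp.span (sym_mon ` insert j S)"
      by (intro bp.span_add bp.span_scale mono g h)
    fix i assume i: "i \<in> insert j S"
    have "(f - (g + scale c h)) * sym_mon i = (f - g) * sym_mon i - scale c (h * sym_mon i)"
      by (simp add: algebra_simps scale_def)
    then have "L ((f - (g + scale c h)) * sym_mon i) = L ((f - g) * sym_mon i) - c * L (h * sym_mon i)"
      using h_sym fg_sym by (simp add: L_linear sym_span_mult sym_span_linear sym_mon_in_sym_span)
    also have "\<dots> = 0"
      using i cj hj g(2)[of i] r(2)[of i] by (cases "i = j") (simp_all add: h_def)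
    finally show "L ((f - (g + scale c h)) * sym_mon i) = 0" .
  qed
qed

end

section \<open>Expansions in monomials preceding a given index\<close>

lemma prec_trans: "i \<prec>\<^sub>d j \<Longrightarrow> j \<prec>\<^sub>d l \<Longrightarrow> i \<prec>\<^sub>d l"
  by (auto simp: prec_def split: prod.splits)

text \<open>Translates between span membership and the coefficient family in
  \<open>is_monic_orth\<close>; \<open>finite_prec\<close> makes the sum a genuine one.\<close>

lemma below_iff: "f \<in> below j \<longleftrightarrow> (\<exists>c. f = (\<Sum>i | i \<prec>\<^sub>d j. scale (c i) (sym_mon i)))"
proof
  assume "f \<in> below j"
  then show "\<exists>c. f = (\<Sum>i | i \<prec>\<^sub>d j. scale (c i) (sym_mon i))"
    unfolding below_def
  proof (induction rule: bp.span_induct_alt)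
    case base
    show ?case by (intro exI[of _ "\<lambda>_. 0"]) simp
  next
    case (step a x f)
    then obtain i c where x: "x = sym_mon i" "i \<prec>\<^sub>d j"
      and f: "f = (\<Sum>i | i \<prec>\<^sub>d j. scale (c i) (sym_mon i))" by auto
    have "scale a x = (\<Sum>l | l \<prec>\<^sub>d j. scale (if l = i then a else 0) (sym_mon l))"
      using x by (simp add: if_distrib[of "\<lambda>a. scale a _"] finite_prec cong: if_cong)
    then have "scale a x + f = (\<Sum>l | l \<prec>\<^sub>d j. scale ((if l = i then a else 0) + c l) (sym_mon l))"
      unfolding f bp.scale_left_distrib sum.distrib by simp
    then show ?case by (rule exI[of _ "\<lambda>l. (if l = i then a else 0) + c l"])
  qed
qed (auto simp: below_def intro!: bp.span_sum intro: bp.span_scale bp.span_base)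

text \<open>With \<open>has_sym_degree_sym_mon\<close>, this reduces orthogonality to all
  lower-degree polynomials to orthogonality to monomials.\<close>

lemma has_sym_degree_below:
  assumes "has_sym_degree q d" "d \<prec>\<^sub>d j" shows "q \<in> below j"
proof -
  obtain c where q: "q = (\<Sum>i | c i \<noteq> 0. scale (c i) (sym_mon i))"
    and c: "\<And>i. c i \<noteq> 0 \<Longrightarrow> i \<prec>\<^sub>d d \<or> i = d"
    using assms(1) unfolding has_sym_degree_def by auto
  have "i \<prec>\<^sub>d j" if "c i \<noteq> 0" for i
    using c[OF that] assms(2) prec_trans by blast
  then show ?thesis
    unfolding q below_def by (intro bp.span_sum bp.span_scale bp.span_base) auto
qed

lemma has_sym_degree_sym_mon: "has_sym_degree (sym_mon i) i"
  unfolding has_sym_degree_def by (rule exI[of _ "\<lambda>l. if l = i then 1 else 0"]) simp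

section \<open>The operators on symmetric polynomials\<close>

lemma eval_dX: "((\<lambda>s. eval f s y) has_real_derivative d) (at x) \<Longrightarrow> eval (dX f) x y = d"
  using eval_has_dX DERIV_unique by blast

lemma eval_dY: "((\<lambda>t. eval f x t) has_real_derivative d) (at y) \<Longrightarrow> eval (dY f) x y = d"
  using eval_has_dY DERIV_unique by blast

text \<open>The formal derivative agrees pointwise with the analytic one and a polynomial is
  determined by its values, so the rules of calculus carry over.\<close>

lemma dX_rules:
  "dX (f + g) = dX f + dX g" "dX (scale c f) = scale c (dX f)" "dX (f * g) = dX f * g + f * dX g"
  by (rule bipoly_eqI, rule eval_dX, simp,
      auto intro!: derivative_eq_intros eval_has_dX simp: algebra_simps)+

lemma dY_rules:
  "dY (f + g) = dY f + dY g" "dY (scale c f) = scale c (dY f)" "dY (f * g) = dY f * g + f * dY g"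
  by (rule bipoly_eqI, rule eval_dY, simp,
      auto intro!: derivative_eq_intros eval_has_dY simp: algebra_simps)+

lemma dX_dY_const: "dX 0 = 0" "dX 1 = 0" "dY 0 = 0" "dY 1 = 0"
  by (simp_all add: dX_def dY_def one_pCons map_poly_pCons)

lemma eval_D_minus':
  assumes "sym_poly f"
  shows "(x - y) * eval (D_minus f) x y = eval (dY f) x y - eval (dX f) x y"
  using arg_cong[OF D_minus_exact[OF assms], of "\<lambda>g. eval g x y"] by simp

lemma D_minus_eqI:
  assumes "sym_poly f" "\<And>x y. (x - y) * eval g x y = eval (dY f) x y - eval (dX f) x y"
  shows "D_minus f = g"
proof (rule bipoly_eqI)
  fix x y :: real assume "y < x"
  then show "eval (D_minus f) x y = eval g x y"
    using eval_D_minus'[OF assms(1), of x y] assms(2)[of x y]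
    by (metis diff_gt_0_iff_gt less_irrefl mult_left_cancel)
qed

lemma D_minus_add:
  assumes "f \<in> sym_span" "g \<in> sym_span"
  shows "D_minus (f + g) = D_minus f + D_minus g"
  using assms
  by (intro D_minus_eqI sym_poly_sym_span sym_span_linear)
    (auto simp: dX_rules dY_rules eval_D_minus' sym_poly_sym_span distrib_left)

lemma D_minus_scale:
  assumes "f \<in> sym_span"
  shows "D_minus (scale c f) = scale c (D_minus f)"
  using assms
  by (intro D_minus_eqI sym_poly_sym_span sym_span_linear)
    (auto simp: dX_rules dY_rules eval_D_minus' sym_poly_sym_span mult.left_commute right_diff_distrib)

lemmas D_minus_linear = D_minus_add D_minus_scale

lemma D_minus_0: "D_minus 0 = 0"
  by (simp add: D_minus_def dX_dY_const)

text \<open>Both partial derivatives of x + y are 1 and cancel in the difference, so only xy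
  contributes, with the factor x - y that is divided out. For k = 0 the truncated
  \<open>k - 1\<close> is harmless because the coefficient is 0.\<close>

lemma D_minus_sym_mon: "D_minus (sym_mon (n, k)) = scale (real k) (sym_mon (n, k - 1))"
proof (rule D_minus_eqI)
  fix x y :: real
  have "eval (dX (sym_mon (n, k))) x y = real n * (x + y) ^ (n - 1) * (x * y) ^ k
      + (x + y) ^ n * (real k * (x * y) ^ (k - 1) * y)"
    by (rule eval_dX) (auto intro!: derivative_eq_intros simp: sym_mon_def)
  moreover have "eval (dY (sym_mon (n, k))) x y = real n * (x + y) ^ (n - 1) * (x * y) ^ k
      + (x + y) ^ n * (real k * (x * y) ^ (k - 1) * x)"
    by (rule eval_dY) (auto intro!: derivative_eq_intros simp: sym_mon_def)
  ultimately show "(x - y) * eval (scale (real k) (sym_mon (n, k - 1))) x y =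
      eval (dY (sym_mon (n, k))) x y - eval (dX (sym_mon (n, k))) x y"
    by (simp add: sym_mon_def algebra_simps)
qed (simp add: sym_poly_sym_span sym_mon_in_sym_span)

lemma D_plus_linear:
  "D_plus \<alpha> \<kappa> 0 = 0"
  "D_plus \<alpha> \<kappa> (f + g) = D_plus \<alpha> \<kappa> f + D_plus \<alpha> \<kappa> g"
  "D_plus \<alpha> \<kappa> (scale c f) = scale c (D_plus \<alpha> \<kappa> f)"
  by (rule bipoly_eqI, simp add: D_plus_eq dX_rules dY_rules dX_dY_const, (simp add: algebra_simps)?)+

text \<open>A Leibniz rule: D_+ is the derivation -xy(x - y)^2 D_- plus multiplication by a
  polynomial, so only the derivation part acts on p.\<close>

lemma D_plus_mult:
  assumes "sym_poly p"
  shows "D_plus \<alpha> \<kappa> (p * q) = p * D_plus \<alpha> \<kappa> q - D_minus p * q * (X * Y * (X - Y) ^ 2)"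
proof (rule bipoly_eqI)
  fix x y :: real
  have "(x - y) * eval (D_minus p) x y = eval (dY p) x y - eval (dX p) x y"
    by (rule eval_D_minus'[OF assms])
  then show "eval (D_plus \<alpha> \<kappa> (p * q)) x y
      = eval (p * D_plus \<alpha> \<kappa> q - D_minus p * q * (X * Y * (X - Y) ^ 2)) x y"
    unfolding D_plus_eq dX_rules dY_rules eval_simps by algebra
qed

text \<open>Take q = 1 in the Leibniz rule and expand (x - y)^2 = (x + y)^2 - 4xy.\<close>

lemma D_plus_sym_mon:
  "D_plus \<alpha> \<kappa> (sym_mon (n, k)) = scale (4 * (real k + \<alpha> + \<kappa> + 2)) (sym_mon (n, Suc k))
     - scale (real k + \<alpha> + 1) (sym_mon (n + 2, k))"
proof (rule bipoly_eqI)
  fix x y :: real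
  let ?p = "sym_mon (n, k)"
  have k: "real k * (x * y) ^ (k - 1) * (x * y) = real k * (x * y) ^ k"
    by (cases k) auto
  have "D_plus \<alpha> \<kappa> ?p = ?p * D_plus \<alpha> \<kappa> 1 - D_minus ?p * (X * Y * (X - Y) ^ 2)"
    using D_plus_mult[of ?p \<alpha> \<kappa> 1] by (simp add: sym_poly_sym_span sym_mon_in_sym_span)
  then have "eval (D_plus \<alpha> \<kappa> ?p) x y = (x + y) ^ n * (x * y) ^ k *
        (4 * (\<kappa> + 1) * (x * y) - (\<alpha> + 1) * (x - y)\<^sup>2)
      - (x + y) ^ n * (real k * (x * y) ^ (k - 1) * (x * y)) * (x - y)\<^sup>2"
    by (simp add: D_minus_sym_mon D_plus_eq dX_dY_const) (simp add: sym_mon_def algebra_simps)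
  then show "eval (D_plus \<alpha> \<kappa> ?p) x y = eval (scale (4 * (real k + \<alpha> + \<kappa> + 2)) (sym_mon (n, Suc k))
     - scale (real k + \<alpha> + 1) (sym_mon (n + 2, k))) x y"
    unfolding k by (simp add: sym_mon_def power2_eq_square) (simp add: algebra_simps)
qed

lemma D_minus_sym_span:
  assumes "f \<in> sym_span" shows "D_minus f \<in> sym_span"
proof -
  \<comment> \<open>Membership of f is carried along because additivity of \<open>D_minus\<close> is
    established on \<open>sym_span\<close>, where the division is exact.\<close>
  have "f \<in> sym_span \<and> D_minus f \<in> sym_span"
    using assms unfolding sym_span_def
  proof (induction rule: bp.span_induct_alt)
    case base
    then show ?case by (simp add: D_minus_0 bp.span_zero)
  next
    case (step c x y)
    then obtain n k where "x = sym_mon (n, k)" by auto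
    then show ?case
      using step unfolding sym_span_def[symmetric]
      by (simp add: D_minus_linear sym_span_linear sym_mon_in_sym_span D_minus_sym_mon)
  qed
  then show ?thesis ..
qed

lemma D_plus_sym_span:
  assumes "f \<in> sym_span" shows "D_plus \<alpha> \<kappa> f \<in> sym_span"
  using assms unfolding sym_span_def
proof (induction rule: bp.span_induct_alt)
  case base
  then show ?case by (simp add: D_plus_linear bp.span_zero)
next
  case (step c x y)
  then obtain n k where "x = sym_mon (n, k)" by auto
  then show ?case
    using step unfolding sym_span_def[symmetric]
    by (simp add: D_plus_linear sym_span_linear sym_mon_in_sym_span D_plus_sym_mon)
qed

lemma D_minus_below:
  assumes "f \<in> below (n, Suc k)" shows "D_minus f \<in> below (n, k)"
proof -
  have "f \<in> sym_span \<and> D_minus f \<in> below (n, k)"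
    using assms unfolding below_def[of "(n, Suc k)"]
  proof (induction rule: bp.span_induct_alt)
    case base
    then show ?case by (simp add: D_minus_0 sym_span_linear below_linear)
  next
    case (step c x y)
    then obtain m l where x: "x = sym_mon (m, l)" and "(m, l) \<prec>\<^sub>d (n, Suc k)" by auto
    \<comment> \<open>For l = 0 the monomial is annihilated; otherwise both weighted degrees drop by
      2 and both second indices by 1, preserving the order.\<close>
    then have "l = 0 \<or> (m, l - 1) \<prec>\<^sub>d (n, k)" by (auto simp: prec_def)
    then have "D_minus x \<in> below (n, k)"
      by (auto simp: x D_minus_sym_mon below_linear intro: below_linear sym_mon_in_below)
    then show ?case
      using step x by (simp add: D_minus_linear sym_span_linear below_linear sym_mon_in_sym_span)
  qed
  then show ?thesis ..
qed

lemma D_plus_below: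
  assumes "f \<in> below (n, k)" shows "D_plus \<alpha> \<kappa> f \<in> below (n, Suc k)"
  using assms unfolding below_def[of "(n, k)"]
proof (induction rule: bp.span_induct_alt)
  case base
  then show ?case by (simp add: D_plus_linear below_linear)
next
  case (step c x y)
  then obtain m l where x: "x = sym_mon (m, l)" and "(m, l) \<prec>\<^sub>d (n, k)" by auto
  \<comment> \<open>Both images have weighted degree m + 2l + 2, and the second index of the latter
    is even smaller.\<close>
  then have "(m, Suc l) \<prec>\<^sub>d (n, Suc k)" "(m + 2, l) \<prec>\<^sub>d (n, Suc k)"
    by (auto simp: prec_def)
  then have "D_plus \<alpha> \<kappa> x \<in> below (n, Suc k)"
    unfolding x D_plus_sym_mon by (intro below_linear sym_mon_in_below)
  then show ?case
    using step by (simp add: D_plus_linear below_linear)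
qed

text \<open>D_+ D_- is triangular for the order. This serves indices (n, 0), from which the second
  index cannot be lowered first.\<close>

lemma D_plus_D_minus_below:
  assumes "f \<in> below j" shows "D_plus \<alpha> \<kappa> (D_minus f) \<in> below j"
proof -
  have "f \<in> sym_span \<and> D_plus \<alpha> \<kappa> (D_minus f) \<in> below j"
    using assms unfolding below_def[of j]
  proof (induction rule: bp.span_induct_alt)
    case base
    then show ?case by (simp add: D_minus_0 D_plus_linear sym_span_linear bp.span_zero)
  next
    case (step c x y)
    then obtain m l where x: "x = sym_mon (m, l)" "(m, l) \<prec>\<^sub>d j" by auto
    have "D_plus \<alpha> \<kappa> (D_minus x) \<in> below j"
    proof (cases l)
      case 0
      then show ?thesis by (simp add: x D_minus_sym_mon D_plus_linear below_linear)
    next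
      case (Suc l')
      \<comment> \<open>The extra monomial has the same weighted degree as (m, l) and a smaller
        second index.\<close>
      have "(m + 2, l') \<prec>\<^sub>d j"
        using x Suc by (intro prec_trans[OF _ x(2)]) (simp add: prec_def)
      then show ?thesis
        unfolding x D_minus_sym_mon D_plus_linear D_plus_sym_mon
        using x(2) Suc by (intro below_linear sym_mon_in_below) auto
    qed
    then show ?case
      using step x unfolding below_def[symmetric]
      by (simp add: D_minus_linear D_plus_linear sym_span_linear below_linear sym_mon_in_sym_span)
  qed
  then show ?thesis ..
qed

section \<open>Adjointness\<close>

text \<open>The quotient of the two weights is the polynomial xy(x - y)^2, so both pairings become
  values of one functional.\<close>

lemma moment_int_shift:
  "moment_int (\<alpha> + 1) \<gamma> (\<kappa> + 1) f = moment_int \<alpha> \<gamma> \<kappa> (f * (X * Y * (X - Y) ^ 2))"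
proof -
  have "integrand (\<alpha> + 1) \<gamma> (\<kappa> + 1) f z = integrand \<alpha> \<gamma> \<kappa> (f * (X * Y * (X - Y) ^ 2)) z" for z
  proof (cases "z \<in> triangle")
    case True
    then have "0 \<le> fst z * snd z" "0 < fst z - snd z"
      by (auto simp: triangle_def simplex2_def)
    moreover have "2 * (\<kappa> + 1) + 1 = (2 * \<kappa> + 1) + 2" by simp
    ultimately have "weight (\<alpha> + 1) \<gamma> (\<kappa> + 1) (fst z) (snd z) =
        weight \<alpha> \<gamma> \<kappa> (fst z) (snd z) * (fst z * snd z * (fst z - snd z)\<^sup>2)"
      unfolding weight_def by (simp only: powr_add) (simp add: algebra_simps)
    then show ?thesis by (simp add: integrand_def)
  qed (simp add: integrand_def)
  then show ?thesis by (simp add: moment_int_eq)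
qed

context weight_parameters
begin

section \<open>Existence and uniqueness of the monic orthogonal basis\<close>

lemma L_orthogonal_below:
  assumes "h \<in> sym_span" "\<And>i. i \<prec>\<^sub>d j \<Longrightarrow> L (h * sym_mon i) = 0" "q \<in> below j"
  shows "L (h * q) = 0"
  using L_orthogonal_span[of h "{i. i \<prec>\<^sub>d j}" q] assms by (simp add: below_def)

lemma is_monic_orth_iff:
  "is_monic_orth \<alpha> \<gamma> \<kappa> n k p \<longleftrightarrow>
     p - sym_mon (n, k) \<in> below (n, k) \<and> (\<forall>i. i \<prec>\<^sub>d (n, k) \<longrightarrow> L (p * sym_mon i) = 0)"
proof
  assume p: "is_monic_orth \<alpha> \<gamma> \<kappa> n k p"
  then have "p - sym_mon (n, k) \<in> below (n, k)"
    by (auto simp: is_monic_orth_def below_iff)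
  moreover have "L (p * sym_mon i) = 0" if "i \<prec>\<^sub>d (n, k)" for i
    using p that has_sym_degree_sym_mon[of i] sym_poly_sym_span[OF sym_mon_in_sym_span]
    unfolding is_monic_orth_def orth_iff by blast
  ultimately show "p - sym_mon (n, k) \<in> below (n, k) \<and> (\<forall>i. i \<prec>\<^sub>d (n, k) \<longrightarrow> L (p * sym_mon i) = 0)"
    by blast
next
  assume p: "p - sym_mon (n, k) \<in> below (n, k) \<and> (\<forall>i. i \<prec>\<^sub>d (n, k) \<longrightarrow> L (p * sym_mon i) = 0)"
  have "p = (p - sym_mon (n, k)) + sym_mon (n, k)" by simp
  then have "p \<in> sym_span"
    using p below_subset sym_mon_in_sym_span sym_span_linear(2) by metis
  moreover have "\<exists>c. p = sym_mon (n, k) + (\<Sum>i | i \<prec>\<^sub>d (n, k). scale (c i) (sym_mon i))"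
    using p by (auto simp: below_iff algebra_simps)
  moreover have "L (p * q) = 0" if "has_sym_degree q d" "d \<prec>\<^sub>d (n, k)" for q d
    using L_orthogonal_below[OF \<open>p \<in> sym_span\<close>] p has_sym_degree_below[OF that] by blast
  ultimately show "is_monic_orth \<alpha> \<gamma> \<kappa> n k p"
    unfolding is_monic_orth_def orth_iff using sym_poly_sym_span by blast
qed

lemma is_monic_orth_sym_span:
  assumes "is_monic_orth \<alpha> \<gamma> \<kappa> n k p" shows "p \<in> sym_span"
proof -
  have "p = (p - sym_mon (n, k)) + sym_mon (n, k)" by simp
  then show ?thesis
    using assms below_subset sym_mon_in_sym_span sym_span_linear(2) is_monic_orth_iff by metis
qed

lemma is_monic_orth_orthogonal:
  assumes p: "is_monic_orth \<alpha> \<gamma> \<kappa> n k p" and q: "q \<in> below (n, k)"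
  shows "L (p * q) = 0"
  using L_orthogonal_below[OF is_monic_orth_sym_span[OF p] _ q] p
  unfolding is_monic_orth_iff by blast

text \<open>The leading monomials cancel in p - q, so p - q is orthogonal to p and to q, hence to
  itself.\<close>

lemma is_monic_orth_unique:
  assumes p: "is_monic_orth \<alpha> \<gamma> \<kappa> n k p" and q: "is_monic_orth \<alpha> \<gamma> \<kappa> n k q"
  shows "p = q"
proof -
  have pq: "p - q \<in> below (n, k)"
    using below_linear(3)[of "p - sym_mon (n, k)" "(n, k)" "q - sym_mon (n, k)"] p q
    by (simp add: is_monic_orth_iff)
  have "L (p * (p - q)) = 0" "L (q * (p - q)) = 0"
    using p q pq by (auto intro: is_monic_orth_orthogonal)
  moreover have "L ((p - q) * (p - q)) = L (p * (p - q)) - L (q * (p - q))"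
    using p q below_subset[OF pq]
    by (simp add: left_diff_distrib L_linear sym_span_mult is_monic_orth_sym_span)
  ultimately have "p - q = 0"
    using L_square_eq_0[OF below_subset[OF pq]] by simp
  then show ?thesis by simp
qed

text \<open>Existence comes from subtracting from the leading monomial its projection onto the lower
  ones; with uniqueness this justifies the definite description.\<close>

lemma is_monic_orth_monic_orth: "is_monic_orth \<alpha> \<gamma> \<kappa> n k (monic_orth \<alpha> \<gamma> \<kappa> n k)"
proof -
  obtain g where "g \<in> below (n, k)"
    and "\<And>i. i \<prec>\<^sub>d (n, k) \<Longrightarrow> L ((sym_mon (n, k) - g) * sym_mon i) = 0"
    using orthogonal_projection[OF finite_prec sym_mon_in_sym_span]
    unfolding below_def by blast
  then have "is_monic_orth \<alpha> \<gamma> \<kappa> n k (sym_mon (n, k) - g)"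
    using below_linear(3)[OF below_linear(1), of g] by (simp add: is_monic_orth_iff)
  then show ?thesis
    unfolding monic_orth_def by (rule theI) (rule is_monic_orth_unique[OF _ \<open>is_monic_orth _ _ _ _ _ _\<close>])
qed

lemma monic_orth_eqI: "is_monic_orth \<alpha> \<gamma> \<kappa> n k p \<Longrightarrow> monic_orth \<alpha> \<gamma> \<kappa> n k = p"
  using is_monic_orth_monic_orth is_monic_orth_unique by blast

section \<open>Vanishing of the integral of D_+ f and the adjoint relation\<close>

lemma L_D_plus:
  assumes "f \<in> sym_span" shows "L (D_plus \<alpha> \<kappa> f) = 0"
proof -
  have "f \<in> sym_span \<and> L (D_plus \<alpha> \<kappa> f) = 0"
    using assms unfolding sym_span_def
  proof (induction rule: bp.span_induct_alt)
    case base
    then show ?case by (simp add: D_plus_linear L_linear bp.span_zero)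
  next
    case (step c x y)
    then obtain n k where x: "x = sym_mon (n, k)" by auto
    \<comment> \<open>Formally this is integration by parts along the segments x + y = const; on a
      monomial it is exactly \<open>moment_rec\<close>.\<close>
    have "L (D_plus \<alpha> \<kappa> x) = 0"
      using moment_rec[OF params(1), of k \<gamma> \<kappa> n] unfolding x D_plus_sym_mon
      by (simp add: L_linear sym_span_linear sym_mon_in_sym_span moment_int_sym_mon[OF params] algebra_simps)
    then show ?case
      using step x unfolding sym_span_def[symmetric]
      by (simp add: D_plus_linear L_linear D_plus_sym_span sym_span_linear sym_mon_in_sym_span)
  qed
  then show ?thesis ..
qed

lemma D_minus_adjoint:
  assumes "f \<in> sym_span" "g \<in> sym_span"
  shows "moment_int (\<alpha> + 1) \<gamma> (\<kappa> + 1) (D_minus f * g) = L (f * D_plus \<alpha> \<kappa> g)"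
proof -
  \<comment> \<open>The polynomial factor turns the base weight into the raised one, and the last
    term has integral zero.\<close>
  have "D_minus f * g * (X * Y * (X - Y) ^ 2) = f * D_plus \<alpha> \<kappa> g - D_plus \<alpha> \<kappa> (f * g)"
    using D_plus_mult[OF sym_poly_sym_span[OF assms(1)]] by simp
  then show ?thesis
    using assms L_D_plus[of "f * g"]
    by (simp add: moment_int_shift L_linear sym_span_mult D_plus_sym_span)
qed

section \<open>The lowering and raising relations\<close>

lemma raised: "weight_parameters (\<alpha> + 1) \<gamma> (\<kappa> + 1)"
  using params by unfold_locales auto

text \<open>The image has norm zero for the raised weight: by adjointness its squared norm pairs p
  with D_+ D_- p. D_- annihilates the leading power of x + y, so D_+ D_- p lies below (n, 0), where
  p is orthogonal to everything.\<close>

lemma D_minus_monic_orth_0: "D_minus (monic_orth \<alpha> \<gamma> \<kappa> n 0) = 0"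
proof -
  interpret up: weight_parameters "\<alpha> + 1" \<gamma> "\<kappa> + 1" by (rule raised)
  define p where "p = monic_orth \<alpha> \<gamma> \<kappa> n 0"
  have p: "is_monic_orth \<alpha> \<gamma> \<kappa> n 0 p" unfolding p_def by (rule is_monic_orth_monic_orth)
  then have p_sym: "p \<in> sym_span" by (rule is_monic_orth_sym_span)
  define r where "r = p - sym_mon (n, 0)"
  have r: "r \<in> below (n, 0)" using p by (simp add: r_def is_monic_orth_iff)
  have "D_minus p = D_minus (sym_mon (n, 0) + r)" by (simp add: r_def)
  also have "\<dots> = D_minus r"
    using below_subset[OF r] by (simp add: D_minus_linear sym_mon_in_sym_span D_minus_sym_mon)
  finally have pr: "D_minus p = D_minus r" .
  have "up.L (D_minus p * D_minus p) = L (p * D_plus \<alpha> \<kappa> (D_minus p))"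
    using p_sym by (intro D_minus_adjoint D_minus_sym_span)
  also have "\<dots> = 0"
    unfolding pr by (intro is_monic_orth_orthogonal[OF p] D_plus_D_minus_below r)
  finally show ?thesis
    using up.L_square_eq_0 D_minus_sym_span[OF p_sym] unfolding p_def by blast
qed

lemma D_minus_monic_orth_Suc:
  "D_minus (monic_orth \<alpha> \<gamma> \<kappa> n (Suc k)) = scale (real (Suc k)) (monic_orth (\<alpha> + 1) \<gamma> (\<kappa> + 1) n k)"
proof -
  interpret up: weight_parameters "\<alpha> + 1" \<gamma> "\<kappa> + 1" by (rule raised)
  define p where "p = monic_orth \<alpha> \<gamma> \<kappa> n (Suc k)"
  have p: "is_monic_orth \<alpha> \<gamma> \<kappa> n (Suc k) p" unfolding p_def by (rule is_monic_orth_monic_orth)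
  then have p_sym: "p \<in> sym_span" by (rule is_monic_orth_sym_span)
  define r where "r = p - sym_mon (n, Suc k)"
  have r: "r \<in> below (n, Suc k)" using p by (simp add: r_def is_monic_orth_iff)
  have "D_minus p = D_minus (sym_mon (n, Suc k) + r)" by (simp add: r_def)
  also have "\<dots> = scale (real (Suc k)) (sym_mon (n, k)) + D_minus r"
    using below_subset[OF r]
    by (simp add: D_minus_linear sym_mon_in_sym_span D_minus_sym_mon del: of_nat_Suc)
  finally have pr: "D_minus p = \<dots>" .
  \<comment> \<open>D_- multiplies the leading coefficient by k + 1; c restores it to 1.\<close>
  define c where "c = 1 / real (Suc k)"
  have "is_monic_orth (\<alpha> + 1) \<gamma> (\<kappa> + 1) n k (scale c (D_minus p))"
    unfolding up.is_monic_orth_iff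
  proof (intro conjI allI impI)
    have "scale c (D_minus p) - sym_mon (n, k) = scale c (D_minus r)"
      by (simp add: pr bp.scale_right_distrib c_def del: of_nat_Suc)
    then show "scale c (D_minus p) - sym_mon (n, k) \<in> below (n, k)"
      using D_minus_below[OF r] by (simp add: below_linear)
    fix i assume "i \<prec>\<^sub>d (n, k)"
    \<comment> \<open>Adjointness moves D_- from p to D_+ on the test monomial, which stays within
      the range where p is orthogonal.\<close>
    then have "D_plus \<alpha> \<kappa> (sym_mon i) \<in> below (n, Suc k)"
      by (intro D_plus_below sym_mon_in_below)
    then have "L (p * D_plus \<alpha> \<kappa> (sym_mon i)) = 0"
      by (rule is_monic_orth_orthogonal[OF p])
    moreover have "scale c (D_minus p) * sym_mon i = scale c (D_minus p * sym_mon i)"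
      by (simp add: scale_def)
    ultimately show "up.L (scale c (D_minus p) * sym_mon i) = 0"
      by (simp add: up.L_linear D_minus_adjoint p_sym sym_mon_in_sym_span)
  qed
  then show ?thesis
    by (simp add: up.monic_orth_eqI c_def p_def[symmetric] del: of_nat_Suc)
qed

lemma D_plus_monic_orth:
  "D_plus \<alpha> \<kappa> (monic_orth (\<alpha> + 1) \<gamma> (\<kappa> + 1) n k) =
     scale (4 * (real k + \<alpha> + \<kappa> + 2)) (monic_orth \<alpha> \<gamma> \<kappa> n (Suc k))"
proof -
  interpret up: weight_parameters "\<alpha> + 1" \<gamma> "\<kappa> + 1" by (rule raised)
  define p where "p = monic_orth (\<alpha> + 1) \<gamma> (\<kappa> + 1) n k"
  have p: "is_monic_orth (\<alpha> + 1) \<gamma> (\<kappa> + 1) n k p"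
    unfolding p_def by (rule up.is_monic_orth_monic_orth)
  then have p_sym: "p \<in> sym_span" by (rule up.is_monic_orth_sym_span)
  define r where "r = p - sym_mon (n, k)"
  have r: "r \<in> below (n, k)" using p by (simp add: r_def up.is_monic_orth_iff)
  define d where "d = 4 * (real k + \<alpha> + \<kappa> + 2)"
  \<comment> \<open>The new leading coefficient is positive since \<alpha> and \<kappa> exceed -1,
    so it can be divided out.\<close>
  have d: "d \<noteq> 0" using params by (simp add: d_def)
  \<comment> \<open>All terms other than the leading one: the index (n + 2, k) has the weighted
    degree of (n, k + 1) but a smaller second index.\<close>
  define q where "q = D_plus \<alpha> \<kappa> r - scale (real k + \<alpha> + 1) (sym_mon (n + 2, k))"
  have "D_plus \<alpha> \<kappa> p = D_plus \<alpha> \<kappa> (sym_mon (n, k) + r)" by (simp add: r_def)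
  also have "\<dots> = scale d (sym_mon (n, Suc k)) + q"
    unfolding D_plus_linear D_plus_sym_mon d_def q_def by (simp add: algebra_simps)
  finally have pq: "D_plus \<alpha> \<kappa> p = \<dots>" .
  have q: "q \<in> below (n, Suc k)"
    unfolding q_def by (intro below_linear D_plus_below r sym_mon_in_below) (simp add: prec_def)
  have "is_monic_orth \<alpha> \<gamma> \<kappa> n (Suc k) (scale (1 / d) (D_plus \<alpha> \<kappa> p))"
    unfolding is_monic_orth_iff
  proof (intro conjI allI impI)
    show "scale (1 / d) (D_plus \<alpha> \<kappa> p) - sym_mon (n, Suc k) \<in> below (n, Suc k)"
      using d q by (simp add: pq bp.scale_right_distrib below_linear)
    fix i assume "i \<prec>\<^sub>d (n, Suc k)"
    \<comment> \<open>The same adjointness read backwards: lowering the test monomial gives zero or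
      a multiple of a monomial below (n, k), to which p is orthogonal.\<close>
    then have "D_minus (sym_mon i) \<in> below (n, k)"
      by (intro D_minus_below sym_mon_in_below)
    then have "up.L (p * D_minus (sym_mon i)) = 0"
      by (rule up.is_monic_orth_orthogonal[OF p])
    then have "L (sym_mon i * D_plus \<alpha> \<kappa> p) = 0"
      using D_minus_adjoint[OF sym_mon_in_sym_span p_sym, of i] by (simp add: mult.commute)
    moreover have "scale (1 / d) (D_plus \<alpha> \<kappa> p) * sym_mon i = scale (1 / d) (sym_mon i * D_plus \<alpha> \<kappa> p)"
      by (simp add: scale_def mult.commute)
    ultimately show "L (scale (1 / d) (D_plus \<alpha> \<kappa> p) * sym_mon i) = 0"
      by (simp add: L_linear)
  qed
  then show ?thesis
    unfolding d_def[symmetric] p_def[symmetric] using d by (simp add: monic_orth_eqI)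
qed

end

theorem theorem5p3:
  fixes \<alpha> \<gamma> \<kappa> :: real
  assumes "\<alpha> > -1" and "\<gamma> > -1" and "\<kappa> > -1" and "\<alpha> + \<kappa> > - 3 / 2"
  shows "\<forall>n k :: nat.
           D_minus (monic_orth \<alpha> \<gamma> \<kappa> n k) =
             (if k = 0 then 0
              else scale (real k) (monic_orth (\<alpha> + 1) \<gamma> (\<kappa> + 1) n (k - 1))) \<and>
           D_plus \<alpha> \<kappa> (monic_orth (\<alpha> + 1) \<gamma> (\<kappa> + 1) n k) =
             scale (4 * (real k + \<alpha> + \<kappa> + 2)) (monic_orth \<alpha> \<gamma> \<kappa> n (k + 1))"
proof (intro allI conjI)
  interpret weight_parameters \<alpha> \<gamma> \<kappa> using assms by unfold_locales
  fix n k :: nat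
  show "D_minus (monic_orth \<alpha> \<gamma> \<kappa> n k) =
      (if k = 0 then 0 else scale (real k) (monic_orth (\<alpha> + 1) \<gamma> (\<kappa> + 1) n (k - 1)))"
    by (cases k) (simp_all add: D_minus_monic_orth_0 D_minus_monic_orth_Suc del: of_nat_Suc)
  show "D_plus \<alpha> \<kappa> (monic_orth (\<alpha> + 1) \<gamma> (\<kappa> + 1) n k) =
      scale (4 * (real k + \<alpha> + \<kappa> + 2)) (monic_orth \<alpha> \<gamma> \<kappa> n (k + 1))"
    by (simp add: D_plus_monic_orth)
qed

end
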